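(* Let $A\in\mathbb{R}^{n\times d}$ and $C\in\mathbb{R}^{n\times k}$ with $\mathrm{rank}(C)=k$, and let $r=\mathrm{rank}(A-CC^{\dagger}A)$. Then there exists a $k$-subset $\widehat S\subset[n]$ such that $C_{\widehat S,:}\in\mathbb{R}^{k\times k}$ is invertible and $$\big\|A-C(C_{\widehat S,:})^{-1}A_{\widehat S,:}\big\|_2^2\ \le\ (1+kr)\cdot\|A-CC^{\dagger}A\|_2^2.$$
   Context: $[n]=\{1,\dots,n\}$; a $k$-subset is a subset with $k$ elements. For a matrix $M$, $M_{S,:}$ is the submatrix of rows indexed by $S$; $M^{\dagger}$ is the Moore–Penrose pseudoinverse; $\|\cdot\|_2$ is the spectral norm. *)

theory Defs
  imports "HOL-Analysis.Analysis"
begin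

text \<open>A real \<open>m \<times> n\<close> matrix has type \<^typ>\<open>real^'n^'m\<close> (row index outermost).
  The spectral norm of \<open>M\<close> is \<^term>\<open>onorm ((*v) M)\<close>, the operator norm
  with respect to the Euclidean norms.\<close>

definition is_pseudoinverse :: "real^'n^'m \<Rightarrow> real^'m^'n \<Rightarrow> bool" where
  "is_pseudoinverse M X \<longleftrightarrow>
     M ** X ** M = M \<and> X ** M ** X = X \<and>
     transpose (M ** X) = M ** X \<and> transpose (X ** M) = X ** M"

text \<open>The Moore--Penrose pseudoinverse: the unique solution of the four Penrose equations.
  Existence and uniqueness, for every matrix, are proved below.\<close>

definition pinv :: "real^'n^'m \<Rightarrow> real^'m^'n" where
  "pinv M = (THE X. is_pseudoinverse M X)"

text \<open>For a set \<open>S\<close> of row indices and a bijection \<open>e\<close> from the index type \<open>'k\<close> onto \<open>S\<close>,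
  \<open>rows_along e M\<close> is the submatrix \<open>M\<^bsub>S,:\<^esub>\<close>, with its rows listed
  in the order given by \<open>e\<close>.\<close>

definition rows_along :: "('k \<Rightarrow> 'm) \<Rightarrow> 'a^'n^'m \<Rightarrow> 'a^'n^'k" where
  "rows_along e M = (\<chi> i. M $ e i)"

lemma ex_bij_betw_card:
  fixes S :: "'m::finite set"
  assumes "card S = CARD('k::finite)"
  shows "\<exists>e. bij_betw e (UNIV :: 'k set) S"
  using assms by (intro finite_same_card_bij) auto

lemma is_pseudoinverse_unique:
  assumes X: "is_pseudoinverse M X" and Y: "is_pseudoinverse M Y"
  shows "X = Y"
proof -
  note pX = X[unfolded is_pseudoinverse_def] and pY = Y[unfolded is_pseudoinverse_def]
  have "M ** X = transpose (M ** Y ** M ** X)"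
    using pX pY by simp
  also have "\<dots> = transpose ((M ** Y) ** (M ** X))"
    by (simp add: matrix_mul_assoc)
  also have "\<dots> = (M ** X) ** (M ** Y)"
    using pX pY by (simp add: matrix_transpose_mul)
  also have "\<dots> = M ** Y"
    using pX by (simp add: matrix_mul_assoc)
  finally have MX: "M ** X = M ** Y" .
  have "X ** M = transpose (X ** (M ** Y ** M))"
    using pX pY by simp
  also have "\<dots> = transpose ((X ** M) ** (Y ** M))"
    by (simp add: matrix_mul_assoc)
  also have "\<dots> = (Y ** M) ** (X ** M)"
    using pX pY by (simp add: matrix_transpose_mul)
  also have "\<dots> = Y ** (M ** X ** M)"
    by (simp add: matrix_mul_assoc)
  also have "\<dots> = Y ** M"
    using pX by simp
  finally have XM: "X ** M = Y ** M" .
  have "X = X ** M ** X"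
    using pX by simp
  also have "\<dots> = Y ** M ** Y"
    using XM MX by (metis matrix_mul_assoc)
  also have "\<dots> = Y"
    using pY by simp
  finally show ?thesis .
qed

lemma ex_orthogonal_projection:
  fixes S :: "(real^'n) set"
  assumes "subspace S"
  shows "\<exists>P :: real^'n^'n. transpose P = P \<and> (\<forall>x. P *v x \<in> S) \<and> (\<forall>x\<in>S. P *v x = x)"
proof -
  obtain B where B: "B \<subseteq> S" "pairwise orthogonal B" "\<And>x. x \<in> B \<Longrightarrow> norm x = 1"
      "independent B" "span B = S"
    using orthonormal_basis_subspace[OF assms] by metis
  have fin: "finite B"
    using B(4) by (rule independent_imp_finite)
  define f where "f = (\<lambda>x. \<Sum>b\<in>B. (b \<bullet> x) *\<^sub>R b)"
  have lin: "linear f"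
    unfolding f_def
    by (intro linearI) (simp_all add: inner_add_right scaleR_add_left sum.distrib scaleR_sum_right)
  define P where "P = matrix f"
  have P: "P *v x = f x" for x
    unfolding P_def using lin by (simp add: matrix_works)
  have sym: "transpose P = P"
  proof -
    have "(transpose P *v y) \<bullet> x = (P *v y) \<bullet> x" for x y
    proof -
      have "(transpose P *v y) \<bullet> x = y \<bullet> (P *v x)"
        by (simp add: dot_lmul_matrix)
      also have "\<dots> = (P *v y) \<bullet> x"
        unfolding P f_def by (simp add: inner_sum_left inner_sum_right inner_commute mult.commute)
      finally show ?thesis .
    qed
    then show ?thesis
      by (metis matrix_eq vector_eq_rdot)
  qed
  have inS: "P *v x \<in> S" for x
    unfolding P f_def B(5)[symmetric]
    by (intro span_sum span_scale) (rule span_base)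
  have fb: "f c = c" if "c \<in> B" for c
  proof -
    have "(b \<bullet> c) *\<^sub>R b = (if b = c then c else 0)" if "b \<in> B" for b
      using B(2,3) \<open>c \<in> B\<close> that by (auto simp: pairwise_def orthogonal_def dot_square_norm)
    then have "f c = (\<Sum>b\<in>B. if b = c then c else 0)"
      unfolding f_def by (intro sum.cong) auto
    then show ?thesis
      using fin \<open>c \<in> B\<close> by simp
  qed
  have "f x = x" if "x \<in> span B" for x
    using linear_eq_on[OF lin linear_id, of x B] that fb by simp
  then show ?thesis
    using sym inS P B(5) by auto
qed

lemma ex_pseudoinverse: "\<exists>X. is_pseudoinverse (M :: real^'n^'m) X"
proof -
  have lin: "linear ((*v) M)"
    by simp
  obtain g where g: "linear g" "\<And>x. M *v (g (M *v x)) = M *v x"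
    using linear_exists_right_inverse_on[OF lin subspace_UNIV] by blast
  define K where "K = {x. M *v x = 0}"
  have "subspace K"
    unfolding K_def using lin by (rule linear_subspace_kernel)
  then obtain Q :: "real^'n^'n" where Q: "transpose Q = Q" "\<And>x. M *v (Q *v x) = 0"
      "\<And>x. M *v x = 0 \<Longrightarrow> Q *v x = x"
    using ex_orthogonal_projection[of K] unfolding K_def by auto
  have "subspace (range ((*v) M))"
    using lin by (intro linear_subspace_image) auto
  then obtain R :: "real^'m^'m" where R: "transpose R = R" "\<And>y. \<exists>x. R *v y = M *v x"
      "\<And>x. R *v (M *v x) = M *v x"
    using ex_orthogonal_projection[of "range ((*v) M)"] by (metis rangeI rangeE)
  define G where "G = matrix g"
  have G: "G *v x = g x" for x
    unfolding G_def using g(1) by (simp add: matrix_works)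
  define V where "V = mat 1 - Q"
  have V: "V *v x = x - Q *v x" for x
    unfolding V_def by (simp add: matrix_vector_mult_diff_rdistrib)
  have MV: "M *v (V *v x) = M *v x" for x
    by (simp add: V Q(2) matrix_vector_mult_diff_distrib)
  have VK: "V *v x = V *v y" if "M *v x = M *v y" for x y
  proof -
    have "Q *v (x - y) = x - y"
      using that by (intro Q(3)) (simp add: matrix_vector_mult_diff_distrib)
    then show ?thesis
      by (simp add: V matrix_vector_mult_diff_distrib algebra_simps)
  qed
  have symV: "transpose V = V"
    using Q(1) unfolding V_def by (simp add: transpose_def mat_def vec_eq_iff)
  define X where "X = V ** G ** R"
  have X: "X *v y = V *v g (R *v y)" for y
    unfolding X_def by (simp add: matrix_vector_mul_assoc[symmetric] G)
  have MX: "M ** X = R"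
    unfolding matrix_eq
    by (metis MV R(2) X g(2) matrix_vector_mul_assoc)
  have XM: "X ** M = V"
    unfolding matrix_eq
    by (metis R(3) VK X g(2) matrix_vector_mul_assoc)
  have "R ** M = M"
    unfolding matrix_eq by (metis R(3) matrix_vector_mul_assoc)
  moreover have "V ** X = X"
    unfolding matrix_eq by (metis MV VK X matrix_vector_mul_assoc)
  ultimately have "is_pseudoinverse M X"
    unfolding is_pseudoinverse_def using MX XM R(1) symV by simp
  then show ?thesis ..
qed

lemma is_pseudoinverse_pinv: "is_pseudoinverse M (pinv M)"
  unfolding pinv_def
  using ex_pseudoinverse[of M] is_pseudoinverse_unique by (metis (mono_tags, lifting) theI)

end

theory Submission
  imports Defs
begin

text \<open>
  Put \<open>B = A - C C\<^sup>\<dagger> A\<close>, whose columns are orthogonal to those of \<open>C\<close>, and write \<open>C = U R\<close> with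
  \<open>R\<close> invertible and \<open>U\<close> having orthonormal columns. For a \<open>k\<close>-subset \<open>S\<close> with invertible \<open>C\<^sub>S\<close>, the
  operator \<open>M \<mapsto> M - C C\<^sub>S\<^sup>-\<^sup>1 M\<^sub>S\<close> annihilates everything of the form \<open>C Y\<close>, so the error for \<open>A\<close> is
  the error for \<open>B\<close>, namely \<open>B - U W\<close> with \<open>U\<^sub>S W = B\<^sub>S\<close>. The two terms are orthogonal and \<open>U\<close> is an
  isometry, hence \<open>\<parallel>B x - U W x\<parallel>\<^sup>2 = \<parallel>B x\<parallel>\<^sup>2 + \<parallel>W x\<parallel>\<^sup>2\<close>, and it is enough to find \<open>S\<close> for which the
  squared Frobenius norm of \<open>W\<close> is at most \<open>k r \<parallel>B\<parallel>\<^sub>2\<^sup>2\<close>.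

  Such an \<open>S\<close> exists by averaging over volume sampling, which picks \<open>S\<close> with probability
  \<open>det(U\<^sub>S)\<^sup>2\<close>. By Cramer's rule, \<open>det(U\<^sub>S)\<^sup>2 W\<^sub>i\<^sub>j\<^sup>2\<close> is the squared minor on \<open>S\<close> of \<open>U\<close> with its column \<open>i\<close>
  replaced by the column \<open>b\<^sub>j\<close> of \<open>B\<close>. The Cauchy--Binet formula turns the sum of these over all \<open>S\<close>
  into a Gram determinant (\<open>sum_det_rows_along_squared\<close>), which equals \<open>\<parallel>b\<^sub>j\<parallel>\<^sup>2\<close> because \<open>b\<^sub>j\<close> is orthogonal
  to the columns of \<open>U\<close> (\<open>det_gram_replace_col\<close>). Summing over \<open>i\<close> and \<open>j\<close>, the expectation of the
  squared Frobenius norm of \<open>W\<close> is at most \<open>k\<close> times that of \<open>B\<close>; so some \<open>S\<close> does as well as this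
  (\<open>exists_rows_cramer_minors_le\<close>). Finally the squared Frobenius norm of \<open>B\<close> is at most
  \<open>r \<parallel>B\<parallel>\<^sub>2\<^sup>2\<close>, since \<open>B\<close> has rank \<open>r\<close> (\<open>sum_column_norms_le_rank_onorm\<close>).

  Throughout, all maps \<open>e\<close> from the column index type to the row index type take the place of
  \<open>k\<close>-subsets: a map that is not injective selects a repeated row and contributes a zero determinant,
  and each subset is counted \<open>k!\<close> times, once for every ordering of its elements. Constant
  factors of this kind cancel in the averaging argument.
\<close>

section \<open>Sums of squared maximal minors\<close>

definition replace_col :: "'k \<Rightarrow> real^'n \<Rightarrow> real^'k^'n \<Rightarrow> real^'k^'n" where
  "replace_col i b M = (\<chi> a j. if j = i then b $ a else M $ a $ j)"

lemma rows_along_mult: "rows_along e (M ** N) = rows_along e M ** N"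
  by (simp add: rows_along_def matrix_matrix_mult_def vec_eq_iff)

lemma rows_along_add: "rows_along e (M + N) = rows_along e M + rows_along e N"
  by (simp add: rows_along_def vec_eq_iff)

text \<open>The selected set is found as the range of one map \<open>e\<close>, but the bound is wanted for every
  enumeration of that set. Reordering rows changes the relevant determinants only by a sign.\<close>

lemma det_rows_along_permute:
  fixes M :: "real^'k^'n"
  assumes "p permutes (UNIV :: 'k set)"
  shows "(det (rows_along (e \<circ> p) M))\<^sup>2 = (det (rows_along e M))\<^sup>2"
proof -
  have "rows_along (e \<circ> p) M = (\<chi> i. rows_along e M $ p i)"
    by (simp add: rows_along_def vec_eq_iff)
  then have "det (rows_along (e \<circ> p) M) = of_int (sign p) * det (rows_along e M)"
    using det_permute_rows[OF assms, of "rows_along e M"] by simp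
  then show ?thesis
    by (simp add: power_mult_distrib sign_def)
qed

text \<open>This is the Cauchy--Binet formula for \<open>M\<^sup>T M\<close>. Summing over all maps, and not only over
  subsets, makes it a short computation: after both determinants are expanded by permutations
  \<open>p\<close> and \<open>q\<close>, the sum over \<open>e\<close> of a product over \<open>i\<close> is a product of sums, each an entry of the Gram
  matrix. For fixed \<open>p\<close> the sum over \<open>q\<close> is then the determinant of the Gram matrix with permuted
  rows, so that the sign of \<open>p\<close> appears twice and cancels.\<close>

proposition sum_det_rows_along_squared:
  fixes M :: "real^'k^'n"
  shows "(\<Sum>e\<in>(UNIV :: ('k \<Rightarrow> 'n) set). (det (rows_along e M))\<^sup>2)
           = fact CARD('k) * det (transpose M ** M)"
proof -
  let ?P = "{p. p permutes (UNIV :: 'k set)}"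
  let ?G = "transpose M ** M"
  have G: "?G $ i $ j = (\<Sum>a\<in>UNIV. M $ a $ i * M $ a $ j)" for i j
    by (simp add: matrix_matrix_mult_def transpose_def)
  have inner: "(\<Sum>e\<in>(UNIV :: ('k \<Rightarrow> 'n) set). (\<Prod>i\<in>UNIV. M $ e i $ p i) * (\<Prod>i\<in>UNIV. M $ e i $ q i))
      = (\<Prod>i\<in>UNIV. ?G $ p i $ q i)" for p q :: "'k \<Rightarrow> 'k"
    unfolding G
    using prod_sum_PiE[of UNIV "\<lambda>_. UNIV" "\<lambda>i a. M $ a $ p i * M $ a $ q i"]
    by (simp add: prod.distrib PiE_UNIV_domain)
  have "(\<Sum>e\<in>(UNIV :: ('k \<Rightarrow> 'n) set). (det (rows_along e M))\<^sup>2)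
      = (\<Sum>e\<in>(UNIV :: ('k \<Rightarrow> 'n) set). \<Sum>p\<in>?P. \<Sum>q\<in>?P. of_int (sign p) * of_int (sign q) *
          ((\<Prod>i\<in>UNIV. M $ e i $ p i) * (\<Prod>i\<in>UNIV. M $ e i $ q i)))"
    unfolding det_def rows_along_def power2_eq_square sum_product
    by (simp add: mult_ac)
  also have "\<dots> = (\<Sum>p\<in>?P. \<Sum>q\<in>?P. of_int (sign p) * of_int (sign q) *
          (\<Sum>e\<in>(UNIV :: ('k \<Rightarrow> 'n) set). (\<Prod>i\<in>UNIV. M $ e i $ p i) * (\<Prod>i\<in>UNIV. M $ e i $ q i)))"
    unfolding sum_distrib_left
    by (subst sum.swap, intro sum.cong refl, rule sum.swap)
  also have "\<dots> = (\<Sum>p\<in>?P. of_int (sign p) * det (\<chi> i. ?G $ p i))"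
    unfolding inner det_def by (simp add: sum_distrib_left mult.assoc)
  also have "\<dots> = (\<Sum>p\<in>?P. det ?G)"
  proof (intro sum.cong refl)
    fix p assume "p \<in> ?P"
    then have "det (\<chi> i. ?G $ p i) = of_int (sign p) * det ?G"
      by (intro det_permute_rows) simp
    then show "of_int (sign p) * det (\<chi> i. ?G $ p i) = det ?G"
      by (simp add: sign_def)
  qed
  also have "\<dots> = fact CARD('k) * det ?G"
    by (simp add: card_permutations)
  finally show ?thesis .
qed

text \<open>Replacing a column by a vector orthogonal to all the others keeps the Gram matrix diagonal:
  its diagonal entries are \<open>1\<close> except for \<open>b \<bullet> b\<close> in position \<open>i\<close>.\<close>

lemma det_gram_replace_col:
  fixes U :: "real^'k^'n"
  assumes U: "transpose U ** U = mat 1" and b: "transpose U *v b = 0"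
  shows "det (transpose (replace_col i b U) ** replace_col i b U) = b \<bullet> b"
proof -
  let ?G = "transpose (replace_col i b U) ** replace_col i b U"
  have UU: "(\<Sum>a\<in>UNIV. U $ a $ p * U $ a $ q) = (if p = q then 1 else 0)" for p q
    using arg_cong[OF U, of "\<lambda>X. X $ p $ q"]
    by (simp add: matrix_matrix_mult_def transpose_def mat_def)
  have Ub: "(\<Sum>a\<in>UNIV. U $ a $ p * b $ a) = 0" for p
    using arg_cong[OF b, of "\<lambda>x. x $ p"]
    by (simp add: matrix_vector_mult_def transpose_def)
  then have bU: "(\<Sum>a\<in>UNIV. b $ a * U $ a $ p) = 0" for p
    by (simp add: mult.commute)
  have G: "?G $ p $ q = (if p = q then if p = i then b \<bullet> b else 1 else 0)" for p q
    by (cases "p = i"; cases "q = i")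
      (simp_all add: matrix_matrix_mult_def transpose_def replace_col_def inner_vec_def UU Ub bU)
  have "det ?G = (\<Prod>p\<in>UNIV. ?G $ p $ p)"
    by (rule det_diagonal) (simp add: G)
  also have "\<dots> = b \<bullet> b"
    by (simp add: G)
  finally show ?thesis .
qed

section \<open>Choosing the rows by averaging\<close>

text \<open>The two sides have the same sum over all \<open>e\<close>, by the two preceding results. If the inequality
  failed for every \<open>e\<close> with nonzero determinant, the sum of the left-hand sides would be strictly
  larger: an \<open>e\<close> with zero determinant has right-hand side zero, and some \<open>e\<close> has nonzero determinant
  because the squares of these determinants add up to \<open>k!\<close>.\<close>

lemma exists_rows_cramer_minors_le:
  fixes U :: "real^'k^'n" and B :: "real^'d^'n"
  assumes U: "transpose U ** U = mat 1" and B: "transpose U ** B = 0"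
  shows "\<exists>e :: 'k \<Rightarrow> 'n. det (rows_along e U) \<noteq> 0 \<and>
    (\<Sum>i\<in>UNIV. \<Sum>j\<in>UNIV. (det (rows_along e (replace_col i (column j B) U)))\<^sup>2)
      \<le> real CARD('k) * (\<Sum>j\<in>UNIV. column j B \<bullet> column j B) * (det (rows_along e U))\<^sup>2"
proof (rule ccontr)
  define c where "c = real CARD('k) * (\<Sum>j\<in>UNIV. column j B \<bullet> column j B)"
  define m where "m = (\<lambda>e :: 'k \<Rightarrow> 'n.
    \<Sum>i\<in>UNIV. \<Sum>j\<in>UNIV. (det (rows_along e (replace_col i (column j B) U)))\<^sup>2)"
  assume "\<not> ?thesis"
  then have less: "c * (det (rows_along e U))\<^sup>2 < m e" if "det (rows_along e U) \<noteq> 0" for e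
    using that unfolding c_def m_def by (meson not_le)
  have le: "c * (det (rows_along e U))\<^sup>2 \<le> m e" for e
  proof (cases "det (rows_along e U) = 0")
    case True
    then show ?thesis by (simp add: m_def sum_nonneg)
  qed (use less in \<open>simp add: less_imp_le\<close>)
  have sumU: "(\<Sum>e\<in>UNIV. (det (rows_along e U))\<^sup>2) = fact CARD('k)"
    by (simp add: sum_det_rows_along_squared U)
  then obtain e0 where "det (rows_along e0 U) \<noteq> 0"
    by (metis (mono_tags, lifting) fact_nonzero power_zero_numeral sum.neutral)
  then have "(\<Sum>e\<in>UNIV. c * (det (rows_along e U))\<^sup>2) < (\<Sum>e\<in>UNIV. m e)"
    using le less by (intro sum_strict_mono_ex1) auto
  moreover have "(\<Sum>e\<in>UNIV. c * (det (rows_along e U))\<^sup>2) = c * fact CARD('k)"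
    by (simp add: sum_distrib_left[symmetric] sumU)
  moreover have "(\<Sum>e\<in>UNIV. m e) = c * fact CARD('k)"
  proof -
    have orth: "transpose U *v column j B = 0" for j
      using arg_cong[OF B, of "column j"]
      by (simp add: vec_eq_iff column_def matrix_matrix_mult_def matrix_vector_mult_def)
    have "(\<Sum>e\<in>UNIV. m e) = (\<Sum>i\<in>UNIV. \<Sum>j\<in>UNIV. \<Sum>e\<in>(UNIV :: ('k \<Rightarrow> 'n) set).
        (det (rows_along e (replace_col i (column j B) U)))\<^sup>2)"
      unfolding m_def by (subst sum.swap, intro sum.cong refl, rule sum.swap)
    also have "\<dots> = (\<Sum>i\<in>(UNIV :: 'k set). \<Sum>j\<in>UNIV. fact CARD('k) * (column j B \<bullet> column j B))"
      by (simp add: sum_det_rows_along_squared det_gram_replace_col[OF U orth])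
    also have "\<dots> = c * fact CARD('k)"
      by (simp add: c_def sum_distrib_left[symmetric])
    finally show ?thesis .
  qed
  ultimately show False by simp
qed

lemma solution_entry_cramer:
  fixes U :: "real^'k^'n" and B :: "real^'d^'n"
  assumes "det (rows_along e U) \<noteq> 0" and "rows_along e U ** W = rows_along e B"
  shows "W $ i $ j = det (rows_along e (replace_col i (column j B) U)) / det (rows_along e U)"
proof -
  have "rows_along e U *v column j W = column j (rows_along e B)"
    unfolding assms(2)[symmetric]
    by (simp add: vec_eq_iff column_def matrix_matrix_mult_def matrix_vector_mult_def)
  then have "column j W = (\<chi> k. det (\<chi> a l. if l = k then column j (rows_along e B) $ a
      else rows_along e U $ a $ l) / det (rows_along e U))"
    using cramer[OF assms(1)] by simp
  then have "column j W $ i = det (\<chi> a l. if l = i then column j (rows_along e B) $ a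
      else rows_along e U $ a $ l) / det (rows_along e U)"
    by simp
  moreover have "(\<chi> a l. if l = i then column j (rows_along e B) $ a else rows_along e U $ a $ l)
      = rows_along e (replace_col i (column j B) U)"
    by (simp add: vec_eq_iff column_def rows_along_def replace_col_def)
  ultimately show ?thesis
    by (simp add: column_def)
qed

section \<open>Spectral and Frobenius norms\<close>

lemma norm_matrix_vector_mult_squared:
  fixes W :: "real^'d^'k"
  shows "(norm (W *v x))\<^sup>2 = (\<Sum>i\<in>UNIV. (W $ i \<bullet> x)\<^sup>2)"
  unfolding power2_norm_eq_inner
  by (subst inner_vec_def) (simp add: matrix_vector_mul_component power2_eq_square)

lemma norm_matrix_vector_le_frobenius:
  fixes W :: "real^'d^'k"
  shows "(norm (W *v x))\<^sup>2 \<le> (\<Sum>i\<in>UNIV. \<Sum>j\<in>UNIV. (W $ i $ j)\<^sup>2) * (norm x)\<^sup>2"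
proof -
  have "(norm (W *v x))\<^sup>2 = (\<Sum>i\<in>UNIV. (W $ i \<bullet> x)\<^sup>2)"
    by (rule norm_matrix_vector_mult_squared)
  also have "\<dots> \<le> (\<Sum>i\<in>UNIV. (W $ i \<bullet> W $ i) * (x \<bullet> x))"
    by (intro sum_mono Cauchy_Schwarz_ineq)
  also have "\<dots> = (\<Sum>i\<in>UNIV. \<Sum>j\<in>UNIV. (W $ i $ j)\<^sup>2) * (norm x)\<^sup>2"
    unfolding sum_distrib_right[symmetric] power2_norm_eq_inner
    by (simp add: inner_vec_def[of "W $ i" for i] power2_eq_square)
  finally show ?thesis .
qed

text \<open>A matrix and its transpose have the same spectral norm; the inequality for the
  transpose follows from \<open>\<parallel>M\<^sup>T v\<parallel>\<^sup>2 = v \<bullet> M (M\<^sup>T v) \<le> \<parallel>v\<parallel> \<parallel>M\<parallel>\<^sub>2 \<parallel>M\<^sup>T v\<parallel>\<close>.\<close>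

lemma norm_transpose_mult_le:
  fixes M :: "real^'d^'n"
  shows "norm (transpose M *v v) \<le> onorm ((*v) M) * norm v"
proof -
  let ?w = "transpose M *v v"
  have "norm ?w * norm ?w = v \<bullet> (M *v ?w)"
    by (metis dot_lmul_matrix vector_transpose_matrix transpose_transpose dot_square_norm power2_eq_square
          transpose_matrix_vector)
  also have "\<dots> \<le> norm v * norm (M *v ?w)"
    by (rule norm_cauchy_schwarz)
  also have "\<dots> \<le> norm v * (onorm ((*v) M) * norm ?w)"
    by (intro mult_left_mono onorm matrix_vector_mul_bounded_linear) simp
  finally have "norm ?w * norm ?w \<le> (onorm ((*v) M) * norm v) * norm ?w"
    by (simp add: mult_ac)
  then show ?thesis
    by (cases "?w = 0") (simp_all add: onorm_pos_le)
qed

text \<open>In an orthonormal basis \<open>V\<close> of the column space, which has \<open>rank M\<close> elements, Parseval's identity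
  rewrites the squared Frobenius norm as the sum of \<open>\<parallel>M\<^sup>T v\<parallel>\<^sup>2\<close> over \<open>v \<in> V\<close>, and each of these
  terms is at most \<open>\<parallel>M\<parallel>\<^sub>2\<^sup>2\<close>.\<close>

lemma sum_column_norms_le_rank_onorm:
  fixes M :: "real^'d^'n"
  shows "(\<Sum>j\<in>UNIV. column j M \<bullet> column j M) \<le> real (rank M) * (onorm ((*v) M))\<^sup>2"
proof -
  obtain V where V: "pairwise orthogonal V" "\<And>v. v \<in> V \<Longrightarrow> norm v = 1" "independent V"
      "card V = dim (span (columns M))" "span V = span (columns M)"
    using orthonormal_basis_subspace[OF subspace_span, of "columns M"] by metis
  have fin: "finite V"
    using V(3) by (rule independent_imp_finite)
  have "column j M \<bullet> column j M = (\<Sum>v\<in>V. (column j M \<bullet> v)\<^sup>2)" for j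
  proof -
    have "column j M \<in> span V"
      unfolding V(5) by (intro span_base) (auto simp: columns_def)
    then have "(\<Sum>v\<in>V. (column j M \<bullet> v) *\<^sub>R v) = column j M"
      using orthonormal_basis_expand[OF V(1,2) _ fin] by simp
    then have "column j M \<bullet> column j M = column j M \<bullet> (\<Sum>v\<in>V. (column j M \<bullet> v) *\<^sub>R v)"
      by simp
    also have "\<dots> = (\<Sum>v\<in>V. (column j M \<bullet> v)\<^sup>2)"
      by (simp add: inner_sum_right power2_eq_square)
    finally show ?thesis .
  qed
  then have "(\<Sum>j\<in>UNIV. column j M \<bullet> column j M) = (\<Sum>v\<in>V. \<Sum>j\<in>UNIV. (column j M \<bullet> v)\<^sup>2)"
    by (simp only:) (rule sum.swap)
  also have "\<dots> = (\<Sum>v\<in>V. (norm (transpose M *v v))\<^sup>2)"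
    by (simp add: norm_matrix_vector_mult_squared transpose_def column_def)
  also have "\<dots> \<le> (\<Sum>v\<in>V. (onorm ((*v) M))\<^sup>2)"
  proof (intro sum_mono power_mono)
    fix v assume "v \<in> V"
    then show "norm (transpose M *v v) \<le> onorm ((*v) M)"
      using norm_transpose_mult_le[of M v] V(2) by simp
  qed simp
  also have "\<dots> = real (rank M) * (onorm ((*v) M))\<^sup>2"
    by (simp add: V(4) column_rank_def)
  finally show ?thesis .
qed

section \<open>Orthogonality of the residual\<close>

text \<open>A QR factorization without the triangular shape of \<open>R\<close>: the columns of \<open>U\<close> are an orthonormal
  basis of the column space of \<open>C\<close>, in any order.\<close>

lemma orthonormal_columns_factorization:
  fixes C :: "real^'k^'n"
  assumes "rank C = CARD('k)"
  obtains U :: "real^'k^'n" and R :: "real^'k^'k"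
  where "transpose U ** U = mat 1" "invertible R" "C = U ** R"
proof -
  obtain V where V: "pairwise orthogonal V" "\<And>v. v \<in> V \<Longrightarrow> norm v = 1" "independent V"
      "card V = dim (span (columns C))" "span V = span (columns C)"
    using orthonormal_basis_subspace[OF subspace_span, of "columns C"] by metis
  have fin: "finite V"
    using V(3) by (rule independent_imp_finite)
  obtain f :: "'k \<Rightarrow> real^'n" where f: "bij_betw f UNIV V"
    using finite_same_card_bij[of "UNIV :: 'k set" V] fin V(4) assms by (auto simp: column_rank_def)
  define U :: "real^'k^'n" where "U = (\<chi> a i. f i $ a)"
  define R where "R = transpose U ** C"
  have ff: "f i \<bullet> f j = (if i = j then 1 else 0)" for i j
  proof (cases "i = j")
    case True
    then show ?thesis
      using V(2)[of "f i"] f by (simp add: dot_square_norm bij_betwE)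
  next
    case False
    then have "f i \<noteq> f j" "f i \<in> V" "f j \<in> V"
      using f by (auto simp: bij_betw_def inj_eq)
    then show ?thesis
      using V(1) False by (auto simp: pairwise_def orthogonal_def)
  qed
  then have UU: "transpose U ** U = mat 1"
    by (simp add: U_def vec_eq_iff matrix_matrix_mult_def transpose_def mat_def inner_vec_def)
  have CUR: "C = U ** R"
  proof -
    have "(U ** R) $ a $ j = C $ a $ j" for a j
    proof -
      have "column j C \<in> span V"
        unfolding V(5) by (intro span_base) (auto simp: columns_def)
      then have "column j C = (\<Sum>v\<in>V. (column j C \<bullet> v) *\<^sub>R v)"
        using orthonormal_basis_expand[OF V(1,2) _ fin] by simp
      also have "\<dots> = (\<Sum>i\<in>UNIV. (column j C \<bullet> f i) *\<^sub>R f i)"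
        by (rule sum.reindex_bij_betw[OF f, symmetric])
      finally have "column j C $ a = (\<Sum>i\<in>UNIV. (column j C \<bullet> f i) *\<^sub>R f i) $ a"
        by (rule arg_cong)
      then show ?thesis
        by (simp add: U_def R_def matrix_matrix_mult_def transpose_def column_def inner_vec_def mult_ac)
    qed
    then show ?thesis by (simp add: vec_eq_iff)
  qed
  have "inj ((*v) C)"
    using assms by (simp add: full_rank_injective)
  then have "inj ((*v) R)"
    unfolding CUR by (auto simp: inj_def matrix_vector_mul_assoc[symmetric])
  then have "invertible R"
    by (simp add: invertible_left_inverse matrix_left_invertible_injective)
  then show ?thesis
    using that UU CUR by blast
qed

lemma matrix_inv_inverse:
  fixes M :: "'a::field^'n^'n"
  assumes "invertible M"
  shows "M ** matrix_inv M = mat 1" and "matrix_inv M ** M = mat 1"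
  using assms someI_ex[of "\<lambda>A'. M ** A' = mat 1 \<and> A' ** M = mat 1"]
  unfolding invertible_def matrix_inv_def by auto

lemma matrix_diff_ldistrib:
  fixes X :: "'a::ring_1^'n^'m"
  shows "X ** (Y - Z) = X ** Y - X ** Z"
  by (simp add: vec_eq_iff matrix_matrix_mult_def right_diff_distrib sum_subtractf)

text \<open>\<open>C C\<^sup>\<dagger>\<close> is symmetric and fixes \<open>C\<close>, so transposing \<open>C C\<^sup>\<dagger> C = C\<close> gives
  \<open>C\<^sup>T C C\<^sup>\<dagger> = C\<^sup>T\<close>.\<close>

lemma transpose_mult_residual_eq_0:
  "transpose C ** (A - C ** pinv C ** A) = 0"
proof -
  have p: "C ** pinv C ** C = C" "transpose (C ** pinv C) = C ** pinv C"
    using is_pseudoinverse_pinv[of C] by (auto simp: is_pseudoinverse_def)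
  have "transpose C = transpose (C ** pinv C ** C)"
    by (simp add: p)
  also have "\<dots> = transpose C ** transpose (C ** pinv C)"
    by (rule matrix_transpose_mul)
  also have "\<dots> = transpose C ** (C ** pinv C)"
    by (simp only: p)
  finally have "transpose C ** (C ** pinv C ** A) = transpose C ** A"
    by (metis matrix_mul_assoc)
  then show ?thesis
    by (simp add: matrix_diff_ldistrib)
qed

text \<open>Pythagoras: \<open>B x\<close> is orthogonal to the range of \<open>U\<close>, and \<open>U\<close> preserves norms.\<close>

lemma norm_residual_minus_correction:
  fixes U :: "real^'k^'n" and B :: "real^'d^'n"
  assumes U: "transpose U ** U = mat 1" and B: "transpose U ** B = 0"
  shows "(norm ((B - U ** W) *v x))\<^sup>2 = (norm (B *v x))\<^sup>2 + (norm (W *v x))\<^sup>2"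
proof -
  let ?b = "B *v x" and ?w = "W *v x"
  have adj: "(U *v y) \<bullet> z = y \<bullet> (transpose U *v z)" for y z
    by (metis dot_lmul_matrix inner_commute transpose_matrix_vector)
  have orth: "(U *v ?w) \<bullet> ?b = 0"
    unfolding adj by (simp add: matrix_vector_mul_assoc B del: transpose_matrix_vector)
  have iso: "(U *v ?w) \<bullet> (U *v ?w) = ?w \<bullet> ?w"
    unfolding adj by (simp add: matrix_vector_mul_assoc matrix_mul_assoc U del: transpose_matrix_vector)
  have "(B - U ** W) *v x = ?b - U *v ?w"
    by (simp add: matrix_vector_mult_diff_rdistrib matrix_vector_mul_assoc)
  then show ?thesis
    using orth iso by (simp add: power2_norm_eq_inner inner_diff_left inner_diff_right inner_commute)
qed

section \<open>Row selection with a spectral error bound\<close>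

theorem theorem1p4:
  fixes A :: "real^'d^'n" and C :: "real^'k^'n" and r :: nat
  assumes "rank C = CARD('k)"
    and "r = rank (A - C ** pinv C ** A)"
  shows "\<exists>S :: 'n set. card S = CARD('k) \<and>
    (\<forall>e :: 'k \<Rightarrow> 'n. bij_betw e UNIV S \<longrightarrow>
       invertible (rows_along e C) \<and>
       (onorm ((*v) (A - C ** matrix_inv (rows_along e C) ** rows_along e A)))\<^sup>2
         \<le> (1 + real CARD('k) * real r) * (onorm ((*v) (A - C ** pinv C ** A)))\<^sup>2)"
proof -
  define B where "B = A - C ** pinv C ** A"
  define F where "F = (\<Sum>j\<in>UNIV. column j B \<bullet> column j B)"
  define minors where "minors = (\<lambda>(e :: 'k \<Rightarrow> 'n) (U :: real^'k^'n).
    \<Sum>i\<in>UNIV. \<Sum>j\<in>UNIV. (det (rows_along e (replace_col i (column j B) U)))\<^sup>2)"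
  obtain U :: "real^'k^'n" and R :: "real^'k^'k" where
    U: "transpose U ** U = mat 1" and R: "invertible R" and CUR: "C = U ** R"
    using orthonormal_columns_factorization[OF assms(1)] .
  have "transpose R ** (transpose U ** B) = 0"
    using transpose_mult_residual_eq_0[of C A]
    by (simp add: B_def CUR matrix_transpose_mul matrix_mul_assoc)
  moreover obtain R' where "R' ** transpose R = mat 1"
    using transpose_invertible[OF R] by (auto simp: invertible_def)
  ultimately have UB: "transpose U ** B = 0"
    by (metis matrix_mul_assoc matrix_mul_lid times0_right)
  obtain e0 :: "'k \<Rightarrow> 'n" where e0: "det (rows_along e0 U) \<noteq> 0"
      "minors e0 U \<le> real CARD('k) * F * (det (rows_along e0 U))\<^sup>2"
    using exists_rows_cramer_minors_le[OF U UB] unfolding F_def minors_def by blast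
  have "inj e0"
  proof (rule ccontr)
    assume "\<not> inj e0"
    then obtain i j where "i \<noteq> j" "e0 i = e0 j"
      by (auto simp: inj_def)
    then have "det (rows_along e0 U) = 0"
      by (intro det_identical_rows[of i j]) (simp_all add: row_def rows_along_def)
    with e0(1) show False by simp
  qed
  have "invertible (rows_along e C) \<and>
      (onorm ((*v) (A - C ** matrix_inv (rows_along e C) ** rows_along e A)))\<^sup>2
         \<le> (1 + real CARD('k) * real r) * (onorm ((*v) B))\<^sup>2"
    if e: "bij_betw e UNIV (range e0)" for e :: "'k \<Rightarrow> 'n"
  proof -
    define p where "p = inv e0 \<circ> e"
    have "bij p"
      unfolding p_def using e \<open>inj e0\<close>
      by (intro bij_betw_trans[OF e]) (simp add: bij_betw_inv_into inj_on_imp_bij_betw)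
    then have p: "p permutes UNIV"
      by (intro bij_imp_permutes) auto
    have "e x \<in> range e0" for x
      using bij_betwE[OF e] by blast
    then have "e0 (p x) = e x" for x
      unfolding p_def comp_def by (rule f_inv_into_f)
    then have "e = e0 \<circ> p"
      by (intro ext) (simp only: comp_apply)
    then have perm: "(det (rows_along e M))\<^sup>2 = (det (rows_along e0 M))\<^sup>2" for M :: "real^'k^'n"
      using det_rows_along_permute[OF p] by simp
    have detU: "det (rows_along e U) \<noteq> 0"
      using e0(1) perm[of U] by auto
    have minors: "minors e U \<le> real CARD('k) * F * (det (rows_along e U))\<^sup>2"
      using e0(2) unfolding minors_def perm .
    have detC: "det (rows_along e C) \<noteq> 0"
      using detU R by (simp add: CUR rows_along_mult det_mul invertible_det_nz)
    then have inv: "invertible (rows_along e C)"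
      by (simp add: invertible_det_nz)
    note Ce = matrix_inv_inverse[OF inv]
    define W where "W = R ** matrix_inv (rows_along e C) ** rows_along e B"
    have UW: "rows_along e U ** W = rows_along e B"
      using Ce(1) unfolding W_def CUR rows_along_mult
      by (metis matrix_mul_assoc matrix_mul_lid)
    have "A = C ** (pinv C ** A) + B"
      by (simp add: B_def matrix_mul_assoc)
    then have "rows_along e A = rows_along e C ** (pinv C ** A) + rows_along e B"
      by (metis rows_along_add rows_along_mult)
    then have "C ** matrix_inv (rows_along e C) ** rows_along e A
        = C ** (matrix_inv (rows_along e C) ** rows_along e C) ** (pinv C ** A)
          + C ** matrix_inv (rows_along e C) ** rows_along e B"
      by (simp add: matrix_add_ldistrib matrix_mul_assoc)
    also have "\<dots> = C ** pinv C ** A + U ** W"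
      unfolding Ce(2) by (simp add: W_def CUR matrix_mul_assoc)
    \<comment> \<open>The component \<open>C C\<^sup>\<dagger> A\<close> of \<open>A\<close> is reproduced exactly, so only \<open>B\<close> contributes to the error.\<close>
    finally have resid: "A - C ** matrix_inv (rows_along e C) ** rows_along e A = B - U ** W"
      by (simp add: B_def)
    have "(\<Sum>i\<in>UNIV. \<Sum>j\<in>UNIV. (W $ i $ j)\<^sup>2) = minors e U / (det (rows_along e U))\<^sup>2"
      by (simp add: solution_entry_cramer[OF detU UW] minors_def power_divide sum_divide_distrib)
    also have "\<dots> \<le> real CARD('k) * F"
      using minors detU by (simp add: divide_le_eq)
    also have "\<dots> \<le> real CARD('k) * (real r * (onorm ((*v) B))\<^sup>2)"
      unfolding F_def using sum_column_norms_le_rank_onorm[of B] assms(2)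
      by (intro mult_left_mono) (simp_all add: B_def)
    finally have W: "(\<Sum>i\<in>UNIV. \<Sum>j\<in>UNIV. (W $ i $ j)\<^sup>2)
        \<le> real CARD('k) * (real r * (onorm ((*v) B))\<^sup>2)" .
    let ?c = "(1 + real CARD('k) * real r) * (onorm ((*v) B))\<^sup>2"
    have "onorm ((*v) (B - U ** W)) \<le> sqrt ?c"
    proof (rule onorm_le)
      fix x :: "real^'d"
      have "(norm ((B - U ** W) *v x))\<^sup>2 = (norm (B *v x))\<^sup>2 + (norm (W *v x))\<^sup>2"
        by (rule norm_residual_minus_correction[OF U UB])
      also have "\<dots> \<le> (onorm ((*v) B) * norm x)\<^sup>2
          + real CARD('k) * (real r * (onorm ((*v) B))\<^sup>2) * (norm x)\<^sup>2"
      proof (intro add_mono power_mono onorm matrix_vector_mul_bounded_linear)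
        show "(norm (W *v x))\<^sup>2 \<le> real CARD('k) * (real r * (onorm ((*v) B))\<^sup>2) * (norm x)\<^sup>2"
          using norm_matrix_vector_le_frobenius[of W x] mult_right_mono[OF W, of "(norm x)\<^sup>2"]
          by simp
      qed simp
      also have "\<dots> = ?c * (norm x)\<^sup>2"
        by (simp add: algebra_simps)
      finally have "sqrt ((norm ((B - U ** W) *v x))\<^sup>2) \<le> sqrt (?c * (norm x)\<^sup>2)"
        by (rule real_sqrt_le_mono)
      then show "norm ((B - U ** W) *v x) \<le> sqrt ?c * norm x"
        by (simp add: real_sqrt_mult)
    qed
    then have "(onorm ((*v) (B - U ** W)))\<^sup>2 \<le> (sqrt ?c)\<^sup>2"
      by (intro power_mono onorm_pos_le matrix_vector_mul_bounded_linear)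
    also have "\<dots> = ?c"
      by (simp add: add_nonneg_nonneg)
    finally show ?thesis
      using inv resid by simp
  qed
  moreover have "card (range e0) = CARD('k)"
    using \<open>inj e0\<close> by (simp add: card_image)
  ultimately show ?thesis
    unfolding B_def by blast
qed

end
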